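(* Let $\Omega=[0,1]$ or $\Omega=[0,\infty)$ with Lebesgue measure, let $F_1,G_1,F_2,G_2$ be $\varphi$-functions, and consider the Orlicz–Lorentz spaces $L_{F_1,G_1}(\Omega)$ and $L_{F_2,G_2}(\Omega)$. Suppose that the identity map is an isometry between them, i.e. $\|f\|_{F_1,G_1}=\|f\|_{F_2,G_2}$ for all $f\in L_{F_1,G_1}$. Then $F_1(t)=F_2(t)$ and $G_1(t)=G_2(t)$ for all $t$ (where, in the case $\Omega=[0,1]$, "for all $t$" means for all $t\in[1,\infty)$, the required domain of these functions in that case; in the case $\Omega=[0,\infty)$ it means for all $t\in[0,\infty)$).
   Context: A $\varphi$-function is a continuous, strictly increasing function $F:[0,\infty)\to[0,\infty)$ with $F(0)=0$, $F(1)=1$ and $\lim_{t\to\infty}F(t)=\infty$. For a $\varphi$-function $F$ put $\widetilde F(t)=1/F(1/t)$ for $t>0$ and $\widetilde F(0)=0$. For a measurable function $f$ on a measure space $(\Omega,\mu)$, the non-increasing rearrangement is $f^*(x)=\sup\{t:\mu(|f|\ge t)\ge x\}$, and for a $\varphi$-function $G$ the Luxemburg functional of a measurable function $g$ is $\|g\|_G=\inf\{c>0:\int G(|g|/c)\le1\}$. For $\varphi$-functions $F,G$ the Orlicz–Lorentz functional is $$\|f\|_{F,G}=\|f^*\circ\widetilde F\circ\widetilde G^{-1}\|_G$$ (the function $f^*\circ\widetilde F\circ\widetilde G^{-1}$ being considered on $[0,\infty)$ with Lebesgue measure; if $\Omega=[0,1]$ then $f^*$ vanishes beyond $1$). The Orlicz–Lorentz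 space $L_{F,G}(\Omega)$ is the vector space of measurable functions $f$ with $\|f\|_{F,G}<\infty$, modulo functions equal to zero a.e. When $\Omega=[0,1]$, the paper's convention is that $F$ and $G$ are only considered as functions on $[1,\infty)$. *)

theory Defs
  imports "HOL-Analysis.Analysis"
begin

definition phi_function :: "(real \<Rightarrow> real) \<Rightarrow> bool" where
  "phi_function F \<longleftrightarrow>
     (\<forall>t\<ge>0. 0 \<le> F t) \<and> continuous_on {0..} F \<and> strict_mono_on {0..} F \<and>
     F 0 = 0 \<and> F 1 = 1 \<and> filterlim F at_top at_top"

definition phi_tilde :: "(real \<Rightarrow> real) \<Rightarrow> real \<Rightarrow> real" where
  "phi_tilde F t = (if t > 0 then 1 / F (1 / t) else 0)"

text \<open>The supremum is taken in \<^typ>\<open>ennreal\<close>: it may be infinite, and it is \<open>0\<close> when no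
  \<open>t\<close> qualifies, so the rearrangement vanishes beyond the total measure of the space.\<close>

definition rearrangement :: "'a measure \<Rightarrow> ('a \<Rightarrow> real) \<Rightarrow> real \<Rightarrow> ennreal" where
  "rearrangement M f x =
     Sup {ennreal t |t. 0 \<le> t \<and> emeasure M {w \<in> space M. \<bar>f w\<bar> \<ge> t} \<ge> ennreal x}"

text \<open>Rearrangements can take the value \<open>\<infinity>\<close> (always at \<open>0\<close>, possibly elsewhere), so a
  \<open>\<phi>\<close>-function is extended to \<open>[0,\<infinity>]\<close> by its limit.\<close>

definition phi_ext :: "(real \<Rightarrow> real) \<Rightarrow> ennreal \<Rightarrow> ennreal" where
  "phi_ext G y = (if y = \<infinity> then \<infinity> else ennreal (G (enn2real y)))"

text \<open>The argument \<open>g\<close> is already nonnegative, so no absolute value is needed.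
  The value is \<open>\<infinity>\<close> if no \<open>c\<close> qualifies.\<close>

definition luxemburg :: "'a measure \<Rightarrow> (real \<Rightarrow> real) \<Rightarrow> ('a \<Rightarrow> ennreal) \<Rightarrow> ennreal" where
  "luxemburg M G g =
     Inf {ennreal c |c. c > 0 \<and> (\<integral>\<^sup>+ x. phi_ext G (g x / ennreal c) \<partial>M) \<le> 1}"

definition orlicz_lorentz_norm ::
  "'a measure \<Rightarrow> (real \<Rightarrow> real) \<Rightarrow> (real \<Rightarrow> real) \<Rightarrow> ('a \<Rightarrow> real) \<Rightarrow> ennreal" where
  "orlicz_lorentz_norm M F G f =
     luxemburg (lebesgue_on {0..}) G
       (rearrangement M f \<circ> phi_tilde F \<circ> inv_into {0..} (phi_tilde G))"

text \<open>Elements are represented by functions rather than by classes modulo equality almost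
  everywhere; the functional does not distinguish functions that agree almost everywhere.\<close>

definition orlicz_lorentz_space ::
  "'a measure \<Rightarrow> (real \<Rightarrow> real) \<Rightarrow> (real \<Rightarrow> real) \<Rightarrow> ('a \<Rightarrow> real) set" where
  "orlicz_lorentz_space M F G = {f \<in> borel_measurable M. orlicz_lorentz_norm M F G f < \<infinity>}"

end

theory Submission imports Defs "HOL-Real_Asymp.Real_Asymp" begin

text \<open>The norm of the indicator of \<open>[0, 1 / F p]\<close> is \<open>1 / p\<close>, which determines \<open>F\<close>. A function with
  value \<open>a\<close> on \<open>[0, 1 / F p]\<close> and \<open>b\<close> on \<open>(1 / F p, 1 / F q]\<close>, \<open>b \<le> a\<close>, has norm \<open>1\<close> iff
  \<open>G b / G q = (G p - G a) / (G p - G q)\<close>. If \<open>G1\<close> and \<open>G2\<close> share these solutions, then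
  \<open>\<phi> = G2 \<circ> inverse of G1\<close> maps the point dividing \<open>[Q, P]\<close> in a given ratio to a point dividing
  \<open>[\<phi> Q, \<phi> P]\<close> in a ratio independent of \<open>P\<close>, and this forces \<open>\<phi>\<close> to be the identity.\<close>

subsection \<open>A functional equation\<close>

text \<open>Nonnegativity makes \<open>L\<close> monotone. Squeezing \<open>n * x\<close> between
  consecutive integers bounds \<open>n * \<bar>L x - x * L 1\<bar>\<close> by \<open>L 1\<close> for
  all large \<open>n\<close>, so the difference vanishes.\<close>

lemma additive_nonneg_imp_linear:
  fixes L :: "real \<Rightarrow> real"
  assumes add: "\<And>x y. x > 0 \<Longrightarrow> y > 0 \<Longrightarrow> L (x + y) = L x + L y"
    and nonneg: "\<And>x. x > 0 \<Longrightarrow> L x \<ge> 0"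
    and "x > 0"
  shows "L x = x * L 1"
proof -
  have mono: "L u \<le> L v" if "0 < u" "u \<le> v" for u v
    using add[of u "v - u"] nonneg[of "v - u"] that by (cases "u = v") auto
  have mult: "L (real (Suc n) * u) = real (Suc n) * L u" if "u > 0" for n u
  proof (induction n)
    case (Suc n)
    have "L (real (Suc (Suc n)) * u) = L (real (Suc n) * u + u)"
      by (simp add: algebra_simps)
    also have "\<dots> = real (Suc n) * L u + L u"
      using add[of "real (Suc n) * u" u] Suc that by simp
    finally show ?case by (simp add: algebra_simps)
  qed simp
  have mult': "L (real n * u) = real n * L u" if "u > 0" "n > 0" for n u
    using mult[OF that(1), of "n - 1"] that(2) by simp
  have bound: "real n * \<bar>L x - x * L 1\<bar> \<le> L 1" if n: "real n * x \<ge> 1" for n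
  proof -
    have "n > 0" using n by (cases n) auto
    \<comment> \<open>The assumption \<open>n * x \<ge> 1\<close> ensures \<open>k > 0\<close>;
      additivity is available only at positive arguments.\<close>
    define k where "k = nat \<lfloor>real n * x\<rfloor>"
    have k: "k > 0" "real k \<le> real n * x" "real n * x \<le> real (Suc k)"
      using n unfolding k_def by linarith+
    have "real k * L 1 \<le> real n * L x"
      using mono[of "real k" "real n * x"] mult'[of 1 k] mult'[OF \<open>x > 0\<close> \<open>n > 0\<close>] k by simp
    moreover have "real n * L x \<le> real (Suc k) * L 1"
      using mono[of "real n * x" "real (Suc k)"] mult'[of 1 "Suc k"] mult'[OF \<open>x > 0\<close> \<open>n > 0\<close>] k n
      by simp
    moreover have "real k * L 1 \<le> real n * x * L 1" "real n * x * L 1 \<le> real (Suc k) * L 1"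
      using k nonneg[of 1] by (auto intro!: mult_right_mono simp del: of_nat_Suc)
    ultimately have "\<bar>real n * L x - real n * x * L 1\<bar> \<le> L 1"
      by (simp add: algebra_simps abs_le_iff)
    moreover have "real n * L x - real n * x * L 1 = real n * (L x - x * L 1)"
      by (simp add: algebra_simps)
    ultimately show ?thesis by (simp add: abs_mult)
  qed
  show ?thesis
  proof (rule ccontr)
    assume "L x \<noteq> x * L 1"
    then have d: "\<bar>L x - x * L 1\<bar> > 0" by simp
    obtain n1 where n1: "real n1 * x > 1" using reals_Archimedean3[OF \<open>x > 0\<close>] by blast
    obtain n2 where n2: "real n2 * \<bar>L x - x * L 1\<bar> > L 1" using reals_Archimedean3[OF d] by blast
    have "real n1 * x \<le> real (max n1 n2) * x"
      using \<open>x > 0\<close> by (intro mult_right_mono) auto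
    with n1 have "real (max n1 n2) * x \<ge> 1" by linarith
    from bound[OF this] have "real (max n1 n2) * \<bar>L x - x * L 1\<bar> \<le> L 1" .
    moreover have "real n2 * \<bar>L x - x * L 1\<bar> \<le> real (max n1 n2) * \<bar>L x - x * L 1\<bar>"
      by (intro mult_right_mono) auto
    ultimately show False using n2 by linarith
  qed
qed

text \<open>The substitution \<open>t = exp (- z)\<close> turns products into sums, and
  \<open>m t < 1\<close> becomes the positivity that replaces continuity in Cauchy's
  equation.\<close>

lemma multiplicative_imp_powr:
  fixes m :: "real \<Rightarrow> real"
  assumes mult: "\<And>s t. 0 < s \<Longrightarrow> s < 1 \<Longrightarrow> 0 < t \<Longrightarrow> t < 1 \<Longrightarrow> m (s * t) = m s * m t"
    and range: "\<And>t. 0 < t \<Longrightarrow> t < 1 \<Longrightarrow> 0 < m t \<and> m t < 1"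
  obtains r where "r > 0" "\<And>t. 0 < t \<Longrightarrow> t < 1 \<Longrightarrow> m t = t powr r"
proof -
  define L where "L z = - ln (m (exp (- z)))" for z
  have pos: "L z > 0" if "z > 0" for z
    using range[of "exp (- z)"] that by (simp add: L_def ln_less_zero)
  have lin: "L z = z * L 1" if "z > 0" for z
  proof (rule additive_nonneg_imp_linear)
    fix x y :: real assume "x > 0" "y > 0"
    then show "L (x + y) = L x + L y"
      using range[of "exp (- x)"] range[of "exp (- y)"] mult[of "exp (- x)" "exp (- y)"]
      by (simp add: L_def ln_mult exp_diff exp_minus field_simps)
  qed (use pos that in \<open>auto intro: less_imp_le\<close>)
  show thesis
  proof
    show "L 1 > 0" by (simp add: pos)
    fix t :: real assume t: "0 < t" "t < 1"
    have "- ln (m t) = - ln t * L 1"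
      using lin[of "- ln t"] t by (simp add: L_def)
    then have "exp (ln (m t)) = exp (L 1 * ln t)" by (simp add: mult.commute)
    then show "m t = t powr L 1" using t range[OF t] by (simp add: powr_def)
  qed
qed

lemma powr_minus_one_tendsto_imp_eq_one:
  fixes r l :: real
  assumes lim: "((\<lambda>t. t powr (r - 1)) \<longlongrightarrow> l) (at_right 0)" and "l > 0"
  shows "r = 1"
proof (rule ccontr)
  assume "r \<noteq> 1"
  then consider "r > 1" | "r < 1" by linarith
  then show False
  proof cases
    case 1
    then have "((\<lambda>t::real. t powr (r - 1)) \<longlongrightarrow> 0) (at_right 0)" by real_asymp
    from tendsto_unique[OF _ this lim] show False using \<open>l > 0\<close> by simp
  next
    case 2
    then have "filterlim (\<lambda>t::real. t powr (r - 1)) at_top (at_right 0)" by real_asymp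
    with lim show False using not_tendsto_and_filterlim_at_infinity[of "at_right (0::real)"]
      filterlim_at_top_imp_at_infinity trivial_limit_at_right_real by blast
  qed
qed

text \<open>For fixed \<open>Q\<close> the equation makes \<open>x \<mapsto> \<phi> (Q + x) - \<phi> Q\<close> homogeneous, hence a power of \<open>x\<close>;
  on the other hand it gives \<open>\<phi> ((1 - t) * Q) = \<phi> Q * (1 - t powr s)\<close>. Comparing the former at
  \<open>Q = 1\<close> with the latter at \<open>Q = 2\<close>, which is differentiable at the point \<open>1\<close>, forces
  the exponent \<open>1\<close>.\<close>

lemma functional_equation_imp_identity:
  fixes \<phi> :: "real \<Rightarrow> real"
  assumes mono: "strict_mono_on {0..} \<phi>" and zero: "\<phi> 0 = 0" and one: "\<phi> 1 = 1"
    and eq: "\<And>Q x t. Q \<ge> 1 \<Longrightarrow> x > 0 \<Longrightarrow> 0 < t \<Longrightarrow> t < 1 \<Longrightarrow>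
      \<phi> Q * (\<phi> (Q + x) - \<phi> (Q + t * x)) = \<phi> ((1 - t) * Q) * (\<phi> (Q + x) - \<phi> Q)"
    and "x \<ge> 0"
  shows "\<phi> x = x"
proof -
  have less: "\<phi> u < \<phi> v" if "0 \<le> u" "u < v" for u v
    using strict_mono_onD[OF mono, of u v] that by simp
  have pos: "\<phi> u > 0" if "u > 0" for u using less[of 0 u] that zero by simp
  \<comment> \<open>Solving \<open>eq\<close> for the increment of \<phi> over \<open>t * x\<close>
    leaves this factor, which does not involve \<open>x\<close>.\<close>
  define m where "m Q t = 1 - \<phi> ((1 - t) * Q) / \<phi> Q" for Q t
  have hom: "\<phi> (Q + t * x) - \<phi> Q = m Q t * (\<phi> (Q + x) - \<phi> Q)"
    if "Q \<ge> 1" "x > 0" "0 < t" "t < 1" for Q x t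
    using eq[OF that] pos[of Q] that(1) by (simp add: m_def field_simps)
  have ex: "\<exists>r>0. \<forall>t. 0 < t \<longrightarrow> t < 1 \<longrightarrow> m Q t = t powr r" if Q: "Q \<ge> 1" for Q
  proof -
    have D: "\<phi> (Q + 1) - \<phi> Q > 0" using less[of Q "Q + 1"] Q by simp
    obtain r where "r > 0" "\<And>t. 0 < t \<Longrightarrow> t < 1 \<Longrightarrow> m Q t = t powr r"
    proof (rule multiplicative_imp_powr[of "m Q"])
      fix s t :: real assume st: "0 < s" "s < 1" "0 < t" "t < 1"
      \<comment> \<open>Shrinking the step 1 by \<open>t\<close> and then by \<open>s\<close> must
        agree with shrinking it by \<open>s * t\<close> at once.\<close>
      have "s * t < 1" using mult_strict_mono[of s 1 t 1] st by simp
      then have "m Q (s * t) * (\<phi> (Q + 1) - \<phi> Q) = m Q s * m Q t * (\<phi> (Q + 1) - \<phi> Q)"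
        using hom[of Q 1 "s * t"] hom[of Q t s] hom[of Q 1 t] st Q
        by (simp only: mult_1_right mult.assoc mult_pos_pos)
      then show "m Q (s * t) = m Q s * m Q t" using D by simp
    next
      fix t :: real assume t: "0 < t" "t < 1"
      have "\<phi> ((1 - t) * Q) > 0" "\<phi> ((1 - t) * Q) < \<phi> Q" "\<phi> Q > 0"
        using pos[of "(1 - t) * Q"] less[of "(1 - t) * Q" Q] pos[of Q] t Q
        by (auto simp: algebra_simps)
      then show "0 < m Q t \<and> m Q t < 1" by (simp add: m_def field_simps)
    qed blast
    then show ?thesis by blast
  qed
  obtain r where r: "r > 0" "\<And>t. 0 < t \<Longrightarrow> t < 1 \<Longrightarrow> m 1 t = t powr r"
    using ex[of 1] by auto
  obtain s where s: "s > 0" "\<And>t. 0 < t \<Longrightarrow> t < 1 \<Longrightarrow> m 2 t = t powr s"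
    using ex[of 2] by auto
  define D where "D = \<phi> 2 - 1"
  have D: "D > 0" using less[of 1 2] one by (simp add: D_def)
  have \<phi>2: "\<phi> 2 > 0" by (simp add: pos)
  \<comment> \<open>The parameter \<open>(1 - t) / 2\<close> is chosen so that the scaled point
    \<open>(1 - (1 - t) / 2) * 2\<close> is \<open>1 + t\<close>; this describes \<phi> on both
    sides of 1.\<close>
  have near: "\<phi> (1 + t) = \<phi> 2 * (1 - ((1 - t) / 2) powr s)" if "-1 < t" "t < 1" for t
  proof -
    have arg: "(1 - (1 - t) / 2) * 2 = 1 + t" for t :: real by (simp add: field_simps)
    have "1 - \<phi> (1 + t) / \<phi> 2 = ((1 - t) / 2) powr s"
      using s(2)[of "(1 - t) / 2", unfolded m_def arg] that by simp
    then show ?thesis using \<phi>2 by (simp add: field_simps)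
  qed
  \<comment> \<open>Both sides express the difference quotient of \<phi> at 1, divided by
    \<open>D\<close>: the left from \<open>Q = 1\<close>, the right from \<open>Q = 2\<close>. The
    right side has a positive limit.\<close>
  have "t powr (r - 1) = \<phi> 2 / D * (((1 / 2) powr s - ((1 - t) / 2) powr s) / t)"
    if t: "0 < t" "t < 1" for t
  proof -
    have "t powr r * D = \<phi> (1 + t) - 1"
      using hom[of 1 1 t] r(2)[OF t] t one by (simp add: D_def)
    also have "\<dots> = \<phi> 2 * ((1 / 2) powr s - ((1 - t) / 2) powr s)"
      using near[of t] near[of 0] t one by (simp add: algebra_simps)
    finally show ?thesis using t D by (simp add: powr_diff field_simps)
  qed
  then have ev: "\<forall>\<^sub>F t in at_right 0.
      \<phi> 2 / D * (((1 / 2) powr s - ((1 - t) / 2) powr s) / t) = t powr (r - 1)"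
    by (auto simp: eventually_at_right_field intro!: exI[of _ 1])
  have "((\<lambda>t::real. ((1 - t) / 2) powr s) has_real_derivative - (s * (1 / 2) powr s)) (at 0)"
    using s(1) by (auto intro!: derivative_eq_intros simp: powr_diff)
  then have "((\<lambda>t. (((1 - t) / 2) powr s - (1 / 2) powr s) / t) \<longlongrightarrow> - (s * (1 / 2) powr s))
      (at_right 0)"
    by (auto simp: has_field_derivative_iff intro: filterlim_mono[OF _ order_refl at_le])
  from tendsto_minus[OF this]
  have "((\<lambda>t. ((1 / 2) powr s - ((1 - t) / 2) powr s) / t) \<longlongrightarrow> s * (1 / 2) powr s) (at_right 0)"
    by (simp add: minus_divide_left)
  from tendsto_mult_left[OF this, of "\<phi> 2 / D"]
  have "((\<lambda>t. t powr (r - 1)) \<longlongrightarrow> \<phi> 2 / D * (s * (1 / 2) powr s)) (at_right 0)"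
    by (rule Lim_transform_eventually[OF _ ev])
  then have "r = 1"
    by (rule powr_minus_one_tendsto_imp_eq_one) (use s D \<phi>2 in auto)
  have hom1: "\<phi> (1 + t * y) - 1 = t * (\<phi> (1 + y) - 1)" if "y > 0" "0 < t" "t < 1" for y t
    using hom[of 1 y t] r(2)[of t] that one \<open>r = 1\<close> by simp
  \<comment> \<open>Homogeneity only shrinks steps: for \<open>y < 1\<close> the step 1 is shrunk to
    \<open>y\<close>, and for \<open>y > 1\<close> the step \<open>y\<close> is shrunk to 1.\<close>
  have affine: "\<phi> (1 + y) = 1 + D * y" if y: "y \<ge> 0" for y
  proof -
    consider "y = 0" | "0 < y" "y < 1" | "y = 1" | "y > 1" using y by linarith
    then show ?thesis
    proof cases
      case 2
      then show ?thesis using hom1[of 1 y] by (simp add: D_def algebra_simps)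
    next
      case 4
      then show ?thesis using hom1[of y "1 / y"] by (simp add: D_def field_simps)
    qed (simp_all add: one D_def)
  qed
  \<comment> \<open>All increments in \<open>eq\<close> now lie where \<phi> is affine, so the slope
    \<open>D\<close> cancels without being known.\<close>
  have scale: "\<phi> (l * Q) = l * \<phi> Q" if "Q \<ge> 1" "0 < l" "l < 1" for l Q
  proof -
    have "\<phi> (Q + 1) - \<phi> (Q + (1 - l) * 1) = l * D" "\<phi> (Q + 1) - \<phi> Q = D"
      using affine[of Q] affine[of "Q - 1"] affine[of "Q - l"] that
      by (simp_all add: algebra_simps)
    then have "\<phi> Q * (l * D) = \<phi> (l * Q) * D"
      using eq[of Q 1 "1 - l"] that by simp
    then show ?thesis using D by (simp add: mult.commute)
  qed
  consider "x = 0" | "0 < x" "x < 1" | "x = 1" | "x > 1" using \<open>x \<ge> 0\<close> by linarith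
  then show ?thesis
  proof cases
    case 2
    then show ?thesis using scale[of 1 x] one by simp
  next
    case 4
    then show ?thesis using scale[of x "1 / x"] one by (simp add: field_simps)
  qed (simp_all add: zero one)
qed

subsection \<open>Norms of step functions\<close>

lemma phi_function_0: "phi_function G \<Longrightarrow> G 0 = 0"
  by (simp add: phi_function_def)

lemma phi_function_nonneg: "phi_function G \<Longrightarrow> 0 \<le> x \<Longrightarrow> 0 \<le> G x"
  by (simp add: phi_function_def)

lemma phi_function_less_iff:
  assumes "phi_function F" "0 \<le> x" "0 \<le> y"
  shows "F x < F y \<longleftrightarrow> x < y"
  using assms strict_mono_on_less[of "{0..}" F x y] by (simp add: phi_function_def)

lemma phi_function_le_iff:
  assumes "phi_function F" "0 \<le> x" "0 \<le> y"
  shows "F x \<le> F y \<longleftrightarrow> x \<le> y"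
  using phi_function_less_iff[OF assms(1,3,2)] by (simp add: not_less[symmetric])

lemma phi_function_pos:
  assumes "phi_function F" "0 < x"
  shows "0 < F x"
  using phi_function_less_iff[OF assms(1), of 0 x] assms by (simp add: phi_function_def)

lemma phi_function_surj:
  assumes F: "phi_function F" and "0 \<le> y"
  obtains x where "0 \<le> x" "F x = y"
proof -
  have "filterlim F at_top at_top" using F by (simp add: phi_function_def)
  then have "\<forall>\<^sub>F x in at_top. y \<le> F x" by (simp add: filterlim_at_top)
  then obtain T where T: "\<And>x. x \<ge> T \<Longrightarrow> y \<le> F x" by (auto simp: eventually_at_top_linorder)
  have "continuous_on {0..max 0 T} F"
    using F by (auto simp: phi_function_def intro: continuous_on_subset)
  with IVT'[of F 0 y "max 0 T"] T[of "max 0 T"] F \<open>0 \<le> y\<close> that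
  show thesis by (auto simp: phi_function_def)
qed

lemma phi_tilde_less_iff:
  assumes F: "phi_function F" and "0 \<le> x" "0 \<le> y"
  shows "phi_tilde F x < phi_tilde F y \<longleftrightarrow> x < y"
proof (cases "0 < x \<and> 0 < y")
  case True
  then show ?thesis
    using phi_function_less_iff[OF F, of "1 / y" "1 / x"]
      phi_function_pos[OF F, of "1 / y"] phi_function_pos[OF F, of "1 / x"]
    by (simp add: phi_tilde_def field_simps)
next
  case False
  then show ?thesis
    using assms phi_function_pos[OF F, of "1 / y"] phi_function_pos[OF F, of "1 / x"]
    by (auto simp: phi_tilde_def)
qed

text \<open>\<open>inv_into\<close> is meaningful only on the image of \<open>phi_tilde F\<close>;
  surjectivity of \<open>F\<close> puts every positive \<open>y\<close> there, with preimage
  \<open>1 / z\<close> where \<open>F z = 1 / y\<close>.\<close>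

lemma inv_into_phi_tilde:
  assumes F: "phi_function F" and "0 < y"
  shows "0 < inv_into {0..} (phi_tilde F) y"
    and "phi_tilde F (inv_into {0..} (phi_tilde F) y) = y"
proof -
  obtain z where z: "0 \<le> z" "F z = 1 / y" using phi_function_surj[OF F, of "1 / y"] \<open>0 < y\<close> by auto
  then have "z \<noteq> 0" using \<open>0 < y\<close> phi_function_0[OF F] by auto
  with z have "phi_tilde F (1 / z) = y" "1 / z \<in> {0..}" using \<open>0 < y\<close> by (auto simp: phi_tilde_def)
  then have "y \<in> phi_tilde F ` {0..}" by blast
  then show *: "phi_tilde F (inv_into {0..} (phi_tilde F) y) = y"
    by (rule f_inv_into_f)
  have "inv_into {0..} (phi_tilde F) y \<in> {0..}"
    using \<open>y \<in> phi_tilde F ` {0..}\<close> by (rule inv_into_into)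
  then show "0 < inv_into {0..} (phi_tilde F) y"
    using * \<open>0 < y\<close> by (auto simp: phi_tilde_def split: if_splits)
qed

section \<open>Rearrangement and modular of two-valued step functions\<close>

definition two_step :: "real \<Rightarrow> real \<Rightarrow> real \<Rightarrow> real \<Rightarrow> real \<Rightarrow> real" where
  "two_step s t a b x = (if x \<le> s then a else if x \<le> t then b else 0)"

lemma two_step_measurable [measurable]:
  "two_step s t a b \<in> borel_measurable (lebesgue_on \<Omega>)"
proof -
  have "two_step s t a b \<in> borel_measurable borel" unfolding two_step_def by measurable
  then have "two_step s t a b \<in> borel_measurable lebesgue" by (simp add: measurable_completion)
  then show ?thesis by (rule measurable_restrict_space1)
qed

text \<open>On the half-line the function is non-increasing, and its jump points belong to the left
  piece, as the condition \<open>\<ge> ennreal x\<close> in the rearrangement requires. At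
  \<open>x = 0\<close> the supremum would be infinite.\<close>

lemma rearrangement_two_step:
  assumes \<Omega>: "\<Omega> \<in> sets lebesgue" "{0..t} \<subseteq> \<Omega>" "\<Omega> \<subseteq> {0..}"
    and st: "0 \<le> s" "s \<le> t" and ab: "0 \<le> b" "b \<le> a" and "0 < x"
  shows "rearrangement (lebesgue_on \<Omega>) (two_step s t a b) x = ennreal (two_step s t a b x)"
proof -
  let ?A = "\<lambda>r. {w \<in> space (lebesgue_on \<Omega>). \<bar>two_step s t a b w\<bar> \<ge> r}"
  have meas: "emeasure (lebesgue_on \<Omega>) {0..u} = ennreal u" if "0 \<le> u" "u \<le> t" for u
    using \<Omega> that by (subst emeasure_restrict_space) auto
  have sets: "?A r \<in> sets (lebesgue_on \<Omega>)" for r by measurable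
  have upper: "emeasure (lebesgue_on \<Omega>) (?A r) \<le> ennreal u"
    if "0 \<le> u" "u \<le> t" "\<And>w. 0 \<le> w \<Longrightarrow> \<bar>two_step s t a b w\<bar> \<ge> r \<Longrightarrow> w \<le> u" for r u
  proof -
    have "?A r \<subseteq> {0..u}" using that \<Omega> by auto
    moreover have "{0..u} \<in> sets (lebesgue_on \<Omega>)"
      using \<Omega> that by (auto simp: sets_restrict_space_iff)
    ultimately have "emeasure (lebesgue_on \<Omega>) (?A r) \<le> emeasure (lebesgue_on \<Omega>) {0..u}"
      by (rule emeasure_mono)
    then show ?thesis unfolding meas[OF that(1,2)] .
  qed
  have lower: "emeasure (lebesgue_on \<Omega>) (?A r) \<ge> ennreal u"
    if "0 \<le> u" "u \<le> t" "\<And>w. 0 \<le> w \<Longrightarrow> w \<le> u \<Longrightarrow> \<bar>two_step s t a b w\<bar> \<ge> r" for r u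
  proof -
    have "{0..u} \<subseteq> ?A r" using that \<Omega> by auto
    then have "emeasure (lebesgue_on \<Omega>) {0..u} \<le> emeasure (lebesgue_on \<Omega>) (?A r)"
      using sets by (rule emeasure_mono)
    then show ?thesis unfolding meas[OF that(1,2)] .
  qed
  show ?thesis
    unfolding rearrangement_def
  proof (rule antisym)
    show "Sup {ennreal r |r. 0 \<le> r \<and> emeasure (lebesgue_on \<Omega>) (?A r) \<ge> ennreal x}
      \<le> ennreal (two_step s t a b x)"
    proof (rule Sup_least)
      fix z assume "z \<in> {ennreal r |r. 0 \<le> r \<and> emeasure (lebesgue_on \<Omega>) (?A r) \<ge> ennreal x}"
      then obtain r where z: "z = ennreal r" and r: "0 \<le> r" "emeasure (lebesgue_on \<Omega>) (?A r) \<ge> ennreal x"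
        by blast
      show "z \<le> ennreal (two_step s t a b x)"
      proof (rule ccontr)
        assume "\<not> ?thesis"
        then have less: "two_step s t a b x < r"
          unfolding z by (meson ennreal_leI not_le)
        \<comment> \<open>\<open>u\<close> is the left end of the plateau containing
          \<open>x\<close>; values above the one at \<open>x\<close> occur only up to
          \<open>u\<close>.\<close>
        define u where "u = (if x \<le> s then 0 else if x \<le> t then s else t)"
        have "u < x" "0 \<le> u" "u \<le> t" using \<open>0 < x\<close> st by (auto simp: u_def)
        moreover have "w \<le> u" if "0 \<le> w" "\<bar>two_step s t a b w\<bar> \<ge> r" for w
          using that less ab st by (auto simp: two_step_def u_def split: if_splits)
        ultimately have "emeasure (lebesgue_on \<Omega>) (?A r) \<le> ennreal u" by (intro upper)
        with r(2) have "ennreal x \<le> ennreal u" by (rule order_trans)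
        then show False using \<open>u < x\<close> \<open>0 < x\<close> \<open>0 \<le> u\<close> by simp
      qed
    qed
  next
    show "ennreal (two_step s t a b x)
      \<le> Sup {ennreal r |r. 0 \<le> r \<and> emeasure (lebesgue_on \<Omega>) (?A r) \<ge> ennreal x}"
    proof (cases "x \<le> t")
      case True
      then have "ennreal x \<le> emeasure (lebesgue_on \<Omega>) (?A (two_step s t a b x))"
        using \<open>0 < x\<close> ab by (intro lower) (auto simp: two_step_def)
      moreover have "0 \<le> two_step s t a b x" using ab by (simp add: two_step_def)
      ultimately show ?thesis by (intro Sup_upper) blast
    next
      case False
      then show ?thesis using st by (simp add: two_step_def)
    qed
  qed
qed

lemma nn_integral_two_step:
  assumes st: "0 \<le> s" "s \<le> t" and ab: "0 \<le> a" "0 \<le> b"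
    and g: "\<And>y. 0 < y \<Longrightarrow> g y = ennreal (two_step s t a b y)"
  shows "(\<integral>\<^sup>+ y. g y \<partial>lebesgue_on {0..}) = ennreal (a * s + b * (t - s))"
proof -
  have "(\<integral>\<^sup>+ y. g y \<partial>lebesgue_on {0..}) = (\<integral>\<^sup>+ y. g y * indicator {0..} y \<partial>lebesgue)"
    by (rule nn_integral_restrict_space) simp
  also have "\<dots> = (\<integral>\<^sup>+ y. ennreal a * indicator {0..s} y + ennreal b * indicator {s<..t} y \<partial>lebesgue)"
  \<comment> \<open>The value of \<open>g\<close> at 0 is not known, but a single point is a null
    set.\<close>
  proof (rule nn_integral_cong_AE, rule AE_I')
    show "{0} \<in> null_sets lebesgue" by simp
    show "{y \<in> space lebesgue. \<not> g y * indicator {0..} y =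
        ennreal a * indicator {0..s} y + ennreal b * indicator {s<..t} y} \<subseteq> {0}"
    proof (rule subsetI, rule ccontr)
      fix y :: real
      assume y: "y \<in> {y \<in> space lebesgue. \<not> g y * indicator {0..} y =
        ennreal a * indicator {0..s} y + ennreal b * indicator {s<..t} y}" "y \<notin> {0}"
      then show False
        using st g[of y] by (cases "y > 0") (auto simp: two_step_def indicator_def split: if_splits)
    qed
  qed
  also have "\<dots> = ennreal a * ennreal s + ennreal b * ennreal (t - s)"
    using st by (subst nn_integral_add) (auto simp: nn_integral_cmult_indicator
        intro!: borel_measurable_times_ennreal borel_measurable_indicator)
  also have "\<dots> = ennreal (a * s + b * (t - s))"
    using st ab by (simp add: ennreal_mult ennreal_plus)
  finally show ?thesis .
qed

text \<open>With \<open>a\<close> on \<open>[0, 1 / F p]\<close> and \<open>b\<close> on \<open>(1 / F p, 1 / F q]\<close>, the substitution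
  \<open>phi_tilde F \<circ> inv_into {0..} (phi_tilde G)\<close> moves the jumps to \<open>1 / G p\<close> and \<open>1 / G q\<close>, so
  that \<open>F\<close> disappears from the norm.\<close>

definition step_modular :: "(real \<Rightarrow> real) \<Rightarrow> real \<Rightarrow> real \<Rightarrow> real \<Rightarrow> real \<Rightarrow> real" where
  "step_modular G p q a b = G a / G p + G b * (1 / G q - 1 / G p)"

lemma modular_two_step:
  assumes F: "phi_function F" and G: "phi_function G"
    and \<Omega>: "\<Omega> \<in> sets lebesgue" "{0..1 / F q} \<subseteq> \<Omega>" "\<Omega> \<subseteq> {0..}"
    and pq: "0 < q" "q \<le> p" and ab: "0 \<le> b" "b \<le> a" and "0 < c"
  shows "(\<integral>\<^sup>+ y. phi_ext G ((rearrangement (lebesgue_on \<Omega>) (two_step (1 / F p) (1 / F q) a b) \<circ>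
      phi_tilde F \<circ> inv_into {0..} (phi_tilde G)) y / ennreal c) \<partial>lebesgue_on {0..}) =
    ennreal (step_modular G p q (a / c) (b / c))"
proof -
  have pos: "0 < F p" "0 < F q" "0 < G p" "0 < G q"
    using phi_function_pos F G pq by auto
  have le: "F q \<le> F p" "G q \<le> G p" using phi_function_le_iff F G pq by auto
  have "(\<integral>\<^sup>+ y. phi_ext G ((rearrangement (lebesgue_on \<Omega>) (two_step (1 / F p) (1 / F q) a b) \<circ>
      phi_tilde F \<circ> inv_into {0..} (phi_tilde G)) y / ennreal c) \<partial>lebesgue_on {0..}) =
    ennreal (G (a / c) * (1 / G p) + G (b / c) * (1 / G q - 1 / G p))"
  proof (rule nn_integral_two_step)
    fix y :: real assume "0 < y"
    define w where "w = inv_into {0..} (phi_tilde G) y"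
    have w: "0 < w" "phi_tilde G w = y"
      using inv_into_phi_tilde[OF G \<open>0 < y\<close>] by (auto simp: w_def)
    have Fw: "0 < phi_tilde F w"
      using phi_function_pos[OF F, of "1 / w"] w by (simp add: phi_tilde_def)
    \<comment> \<open>Both inequalities say \<open>w \<le> 1 / u\<close>, read through one or the
      other increasing function.\<close>
    have jump: "phi_tilde F w \<le> 1 / F u \<longleftrightarrow> y \<le> 1 / G u" if "0 < u" for u
    proof -
      have "1 / F u = phi_tilde F (1 / u)" "1 / G u = phi_tilde G (1 / u)"
        using that by (auto simp: phi_tilde_def)
      then show ?thesis
        using phi_tilde_less_iff[OF F, of "1 / u" w] phi_tilde_less_iff[OF G, of "1 / u" w] w that
        by (simp add: not_less[symmetric])
    qed
    have "rearrangement (lebesgue_on \<Omega>) (two_step (1 / F p) (1 / F q) a b) (phi_tilde F w) =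
        ennreal (two_step (1 / F p) (1 / F q) a b (phi_tilde F w))"
      using \<Omega> pos le ab Fw by (intro rearrangement_two_step) (auto simp: field_simps)
    also have "\<dots> = ennreal (two_step (1 / G p) (1 / G q) a b y)"
      using jump[of p] jump[of q] pq by (simp add: two_step_def)
    finally have "phi_ext G ((rearrangement (lebesgue_on \<Omega>) (two_step (1 / F p) (1 / F q) a b) \<circ>
      phi_tilde F \<circ> inv_into {0..} (phi_tilde G)) y / ennreal c) =
      phi_ext G (ennreal (two_step (1 / G p) (1 / G q) a b y / c))"
      using \<open>0 < c\<close> ab by (simp add: w_def divide_ennreal two_step_def)
    also have "\<dots> = ennreal (two_step (1 / G p) (1 / G q) (G (a / c)) (G (b / c)) y)"
      using \<open>0 < c\<close> ab phi_function_0[OF G] by (simp add: phi_ext_def two_step_def)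
    finally show "phi_ext G ((rearrangement (lebesgue_on \<Omega>) (two_step (1 / F p) (1 / F q) a b) \<circ>
      phi_tilde F \<circ> inv_into {0..} (phi_tilde G)) y / ennreal c) =
      ennreal (two_step (1 / G p) (1 / G q) (G (a / c)) (G (b / c)) y)" .
  qed (use pos le ab \<open>0 < c\<close> phi_function_nonneg[OF G] in \<open>auto simp: field_simps\<close>)
  then show ?thesis by (simp add: step_modular_def)
qed

section \<open>From the modular to the norm\<close>

lemma step_modular_less:
  assumes G: "phi_function G" and pq: "0 < q" "q \<le> p"
    and "0 \<le> b" "0 \<le> a" "b \<le> b'" "a < a'"
  shows "step_modular G p q a b < step_modular G p q a' b'"
proof -
  have "0 < G p" "0 < G q" "G q \<le> G p" "G a < G a'" "G b \<le> G b'"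
    using assms phi_function_pos[OF G] phi_function_le_iff[OF G] phi_function_less_iff[OF G] by auto
  \<comment> \<open>Strictness must come from the first summand: the coefficient of the second
    vanishes when \<open>p = q\<close>.\<close>
  then show ?thesis unfolding step_modular_def
    by (intro add_less_le_mono divide_strict_right_mono mult_right_mono) (auto simp: field_simps)
qed

text \<open>The modular decreases strictly in the scaling constant, so the admissible constants are
  exactly those from \<open>c\<close> upwards.\<close>

lemma orlicz_lorentz_norm_two_step:
  assumes F: "phi_function F" and G: "phi_function G"
    and \<Omega>: "\<Omega> \<in> sets lebesgue" "{0..1 / F q} \<subseteq> \<Omega>" "\<Omega> \<subseteq> {0..}"
    and pq: "0 < q" "q \<le> p" and ab: "0 \<le> b" "b \<le> a" "0 < a"
    and c: "0 < c" "step_modular G p q (a / c) (b / c) = 1"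
  shows "orlicz_lorentz_norm (lebesgue_on \<Omega>) F G (two_step (1 / F p) (1 / F q) a b) = ennreal c"
proof -
  have iff: "ennreal (step_modular G p q (a / d) (b / d)) \<le> 1 \<longleftrightarrow> c \<le> d" if "0 < d" for d
  proof -
    have "step_modular G p q (a / c) (b / c) < step_modular G p q (a / d) (b / d)" if "d < c"
      using that \<open>0 < d\<close> c(1) ab
      by (intro step_modular_less[OF G pq]) (auto simp: frac_le divide_strict_left_mono)
    moreover have "step_modular G p q (a / d) (b / d) < step_modular G p q (a / c) (b / c)" if "c < d"
      using that \<open>0 < d\<close> c(1) ab
      by (intro step_modular_less[OF G pq]) (auto simp: frac_le divide_strict_left_mono)
    ultimately show ?thesis using c(2) by (cases c d rule: linorder_cases) auto
  qed
  have "orlicz_lorentz_norm (lebesgue_on \<Omega>) F G (two_step (1 / F p) (1 / F q) a b) =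
      Inf {ennreal d |d. 0 < d \<and> ennreal (step_modular G p q (a / d) (b / d)) \<le> 1}"
    unfolding orlicz_lorentz_norm_def luxemburg_def
    using modular_two_step[OF F G \<Omega> pq ab(1,2)]
    by (intro arg_cong[where f = Inf] Collect_cong ex_cong) auto
  also have "\<dots> = Inf {ennreal d |d. 0 < d \<and> c \<le> d}"
    using iff by (intro arg_cong[where f = Inf] Collect_cong) auto
  also have "\<dots> = ennreal c"
    by (rule Inf_eqI) (use c(1) in \<open>auto intro: ennreal_leI\<close>)
  finally show ?thesis .
qed

text \<open>Intermediate value theorem in the factor \<open>z = 1 / c\<close>. At
  \<open>z = q / a\<close> the scaled values are at most \<open>q\<close>, which bounds the modular
  by 1; at \<open>z = p / a\<close> the first summand alone is 1.\<close>

lemma step_modular_eq_1_ex: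
  assumes G: "phi_function G" and pq: "0 < q" "q \<le> p" and ab: "0 \<le> b" "b \<le> a" "0 < a"
  obtains c where "0 < c" "step_modular G p q (a / c) (b / c) = 1"
proof -
  have pos: "0 < G p" "0 < G q" "G q \<le> G p"
    using pq phi_function_pos[OF G] phi_function_le_iff[OF G] by auto
  define h where "h z = step_modular G p q (a * z) (b * z)" for z
  have cont: "continuous_on {0..} G" using G by (simp add: phi_function_def)
  have "continuous_on {q / a..p / a} h"
    unfolding h_def step_modular_def using pq ab pos
    by (intro continuous_intros continuous_on_compose2[OF cont])
       (auto intro!: mult_nonneg_nonneg intro: order_trans[of _ "q / a"] zero_le_divide_iff)
  moreover have "h (q / a) \<le> 1"
  proof -
    have "b * (q / a) \<le> q" using pq ab by (simp add: field_simps)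
    then have "G (b * (q / a)) \<le> G q" using phi_function_le_iff[OF G] pq ab by simp
    then have "G (b * (q / a)) * (1 / G q - 1 / G p) \<le> G q * (1 / G q - 1 / G p)"
      using pos by (intro mult_right_mono) (auto simp: field_simps)
    then show ?thesis using pos ab by (simp add: h_def step_modular_def algebra_simps)
  qed
  moreover have "1 \<le> h (p / a)"
  proof -
    have "0 \<le> G (b * (p / a)) * (1 / G q - 1 / G p)"
      using pos pq ab phi_function_nonneg[OF G] by (intro mult_nonneg_nonneg) (auto simp: field_simps)
    then show ?thesis using pos ab by (simp add: h_def step_modular_def)
  qed
  moreover have "q / a \<le> p / a" using pq ab by (simp add: divide_right_mono)
  ultimately obtain z where z: "q / a \<le> z" "h z = 1" using IVT'[of h "q / a" 1 "p / a"] by auto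
  have "0 < q / a" using pq ab by simp
  then have "0 < z" using z by linarith
  with z that[of "1 / z"] show thesis by (simp add: h_def)
qed

lemma orlicz_lorentz_norm_two_step_eq_1_iff:
  assumes F: "phi_function F" and G: "phi_function G"
    and \<Omega>: "\<Omega> \<in> sets lebesgue" "{0..1 / F q} \<subseteq> \<Omega>" "\<Omega> \<subseteq> {0..}"
    and pq: "0 < q" "q \<le> p" and ab: "0 \<le> b" "b \<le> a" "0 < a"
  shows "orlicz_lorentz_norm (lebesgue_on \<Omega>) F G (two_step (1 / F p) (1 / F q) a b) = 1 \<longleftrightarrow>
    step_modular G p q a b = 1"
proof
  assume *: "orlicz_lorentz_norm (lebesgue_on \<Omega>) F G (two_step (1 / F p) (1 / F q) a b) = 1"
  obtain c where c: "0 < c" "step_modular G p q (a / c) (b / c) = 1"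
    using step_modular_eq_1_ex[OF G pq ab] .
  with * orlicz_lorentz_norm_two_step[OF assms c] have "c = 1" by simp
  with c show "step_modular G p q a b = 1" by simp
next
  assume "step_modular G p q a b = 1"
  then show "orlicz_lorentz_norm (lebesgue_on \<Omega>) F G (two_step (1 / F p) (1 / F q) a b) = 1"
    using orlicz_lorentz_norm_two_step[OF assms, of 1] by simp
qed

text \<open>For \<open>q = p\<close> the second coefficient vanishes, and the condition on
  \<open>c\<close> reads \<open>G (1 / c) = G p\<close>, whose solution does not depend on
  \<open>G\<close>.\<close>

lemma orlicz_lorentz_norm_char:
  assumes F: "phi_function F" and G: "phi_function G"
    and \<Omega>: "\<Omega> \<in> sets lebesgue" "{0..1 / F p} \<subseteq> \<Omega>" "\<Omega> \<subseteq> {0..}" and "0 < p"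
  shows "orlicz_lorentz_norm (lebesgue_on \<Omega>) F G (two_step (1 / F p) (1 / F p) 1 0) = ennreal (1 / p)"
proof -
  have "step_modular G p p (1 / (1 / p)) (0 / (1 / p)) = 1"
    using phi_function_pos[OF G \<open>0 < p\<close>] by (simp add: step_modular_def)
  then show ?thesis using assms by (intro orlicz_lorentz_norm_two_step) auto
qed

subsection \<open>Uniqueness\<close>

text \<open>Restricting both functions to arguments at least \<open>\<tau>\<close> covers both spaces: \<open>\<tau> = 1\<close> for
  \<open>[0, 1]\<close>, and \<open>\<tau> = 0\<close> for \<open>[0, \<infinity>)\<close>.\<close>

context
  fixes \<Omega> :: "real set" and F1 G1 F2 G2 :: "real \<Rightarrow> real" and \<tau> :: real
  assumes F1: "phi_function F1" and G1: "phi_function G1"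
    and F2: "phi_function F2" and G2: "phi_function G2"
    and \<Omega>: "\<Omega> \<in> sets lebesgue" "\<Omega> \<subseteq> {0..}"
    and sub: "\<And>F q. phi_function F \<Longrightarrow> 0 < q \<Longrightarrow> \<tau> \<le> q \<Longrightarrow> {0..1 / F q} \<subseteq> \<Omega>"
    and \<tau>: "\<tau> = 0 \<or> \<tau> = 1"
    and isometry: "\<And>f. f \<in> orlicz_lorentz_space (lebesgue_on \<Omega>) F1 G1 \<Longrightarrow>
      orlicz_lorentz_norm (lebesgue_on \<Omega>) F1 G1 f = orlicz_lorentz_norm (lebesgue_on \<Omega>) F2 G2 f"
begin

text \<open>With \<open>F2 p2 = F1 p\<close>, one indicator function has norm \<open>1 / p\<close>
  in the first space and \<open>1 / p2\<close> in the second.\<close>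

lemma isometry_imp_F_eq:
  assumes p: "0 < p" "\<tau> \<le> p"
  shows "F1 p = F2 p"
proof -
  obtain p2 where p2: "0 \<le> p2" "F2 p2 = F1 p"
    using phi_function_surj[OF F2, of "F1 p"] phi_function_nonneg[OF F1, of p] p by auto
  have "F1 p > 0" using phi_function_pos[OF F1 p(1)] .
  then have "p2 \<noteq> 0" using p2 phi_function_0[OF F2] by auto
  with p2 have "0 < p2" by simp
  \<comment> \<open>This keeps the interval inside \<Omega>; for \<tau> = 1 it rests on the
    normalization \<open>F1 1 = F2 1 = 1\<close>.\<close>
  have "\<tau> \<le> p2"
    using \<tau>
  proof
    assume "\<tau> = 1"
    then have "F2 1 \<le> F2 p2"
      using phi_function_le_iff[OF F1, of 1 p] p p2 F1 F2 by (simp add: phi_function_def)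
    then show ?thesis using \<open>\<tau> = 1\<close> phi_function_le_iff[OF F2, of 1 p2] p2 by simp
  qed (use p2 in simp)
  let ?f = "two_step (1 / F1 p) (1 / F1 p) 1 0"
  have n1: "orlicz_lorentz_norm (lebesgue_on \<Omega>) F1 G1 ?f = ennreal (1 / p)"
    using orlicz_lorentz_norm_char[OF F1 G1 \<Omega>(1) sub[OF F1 p] \<Omega>(2) p(1)] .
  have n2: "orlicz_lorentz_norm (lebesgue_on \<Omega>) F2 G2 ?f = ennreal (1 / p2)"
    using orlicz_lorentz_norm_char[OF F2 G2 \<Omega>(1) sub[OF F2 \<open>0 < p2\<close> \<open>\<tau> \<le> p2\<close>] \<Omega>(2) \<open>0 < p2\<close>] p2 by simp
  have "?f \<in> orlicz_lorentz_space (lebesgue_on \<Omega>) F1 G1"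
    using n1 by (simp add: orlicz_lorentz_space_def)
  from isometry[OF this] have "1 / p = 1 / p2" using n1 n2 p \<open>0 < p2\<close> by simp
  then show ?thesis using p2 p by simp
qed

lemma isometry_imp_step_modular:
  assumes pq: "0 < q" "\<tau> \<le> q" "q \<le> p" and ab: "0 \<le> b" "b \<le> a" "0 < a"
    and "step_modular G1 p q a b = 1"
  shows "step_modular G2 p q a b = 1"
proof -
  let ?f = "two_step (1 / F1 p) (1 / F1 q) a b"
  have F: "F1 p = F2 p" "F1 q = F2 q" using isometry_imp_F_eq pq by auto
  have n1: "orlicz_lorentz_norm (lebesgue_on \<Omega>) F1 G1 ?f = 1"
    using orlicz_lorentz_norm_two_step_eq_1_iff[OF F1 G1 \<Omega>(1) sub[OF F1 pq(1,2)] \<Omega>(2) pq(1,3) ab]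
      assms by simp
  then have "?f \<in> orlicz_lorentz_space (lebesgue_on \<Omega>) F1 G1"
    by (simp add: orlicz_lorentz_space_def)
  from isometry[OF this] n1 show ?thesis
    using orlicz_lorentz_norm_two_step_eq_1_iff[OF F2 G2 \<Omega>(1) sub[OF F2 pq(1,2)] \<Omega>(2) pq(1,3) ab]
    by (simp add: F)
qed

text \<open>Even for \<tau> = 1 the result reaches arguments below 1: only the jump parameters
  \<open>p\<close> and \<open>q\<close> are bounded below by \<tau>, while the value
  \<open>b\<close> may be arbitrarily small.\<close>

lemma isometry_imp_G_eq:
  assumes "0 \<le> t"
  shows "G1 t = G2 t"
proof -
  have "\<exists>x\<ge>0. G1 x = y" if "y \<ge> 0" for y using phi_function_surj[OF G1 that] by blast
  then obtain H where H: "\<And>y. y \<ge> 0 \<Longrightarrow> H y \<ge> 0" "\<And>y. y \<ge> 0 \<Longrightarrow> G1 (H y) = y" by metis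
  have H_less: "H x < H y \<longleftrightarrow> x < y" if "0 \<le> x" "0 \<le> y" for x y
    using phi_function_less_iff[OF G1, of "H x" "H y"] H that by simp
  have H_G1: "H (G1 x) = x" if "0 \<le> x" for x
  proof -
    have nn: "0 \<le> G1 x" using that phi_function_nonneg[OF G1] by simp
    have "G1 (H (G1 x)) = G1 x" using H(2)[OF nn] .
    then show ?thesis
      using phi_function_le_iff[OF G1, of "H (G1 x)" x] phi_function_le_iff[OF G1, of x "H (G1 x)"]
        that H(1)[OF nn] by simp
  qed
  have H0: "H 0 = 0" using H_G1[of 0] phi_function_0[OF G1] by simp
  have H1: "H 1 = 1" using H_G1[of 1] G1 by (simp add: phi_function_def)
  define \<phi> where "\<phi> y = G2 (H y)" for y
  have "\<phi> y = y" if "0 \<le> y" for y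
  proof (rule functional_equation_imp_identity)
    show "strict_mono_on {0..} \<phi>"
      by (rule strict_mono_onI)
         (use H H_less phi_function_less_iff[OF G2] in \<open>simp add: \<phi>_def\<close>)
    show "\<phi> 0 = 0" "\<phi> 1 = 1" using H0 H1 G2 by (auto simp: \<phi>_def phi_function_def)
    fix Q x t :: real assume *: "Q \<ge> 1" "x > 0" "0 < t" "t < 1"
    have ord: "0 < (1 - t) * Q" "(1 - t) * Q < Q" "Q < Q + t * x" "Q + t * x < Q + x"
      using * by (auto simp: algebra_simps)
    \<comment> \<open>Measured by \<open>G1\<close>, \<open>?a\<close> divides the segment from
      \<open>?q\<close> to \<open>?p\<close> in the ratio \<open>t : 1 - t\<close> and
      \<open>?b\<close> is the fraction \<open>1 - t\<close> of \<open>?q\<close>; this solves the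
      modular equation for \<open>G1\<close>.\<close>
    let ?b = "H ((1 - t) * Q)" and ?q = "H Q" and ?a = "H (Q + t * x)" and ?p = "H (Q + x)"
    have b: "0 < ?b" using H_less[of 0 "(1 - t) * Q"] H0 ord by simp
    have o: "?b < ?q" "?q < ?a" "?a < ?p" "1 \<le> ?q"
      using H_less[of "(1 - t) * Q" Q] H_less[of Q "Q + t * x"] H_less[of "Q + t * x" "Q + x"]
        H_less[of Q 1] H1 ord * by auto
    have "(Q + t * x) / (Q + x) + (1 - t) * Q * (1 / Q - 1 / (Q + x)) = 1"
    proof -
      have "(1 - t) * Q * (1 / Q - 1 / (Q + x)) = (1 - t) - (1 - t) * Q / (Q + x)"
        using * by (simp add: right_diff_distrib)
      then have "?thesis \<longleftrightarrow> (Q + t * x) / (Q + x) - (1 - t) * Q / (Q + x) = t"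
        by linarith
      also have "\<dots> \<longleftrightarrow> t * (Q + x) / (Q + x) = t"
        by (simp add: diff_divide_distrib[symmetric] algebra_simps)
      finally show ?thesis using * by simp
    qed
    then have "step_modular G1 ?p ?q ?a ?b = 1"
      using H(2) ord * by (simp add: step_modular_def)
    then have "step_modular G2 ?p ?q ?a ?b = 1"
      using b o \<tau> by (intro isometry_imp_step_modular) auto
    moreover have "0 < \<phi> Q" "0 < \<phi> (Q + x)"
      using phi_function_pos[OF G2] b o by (auto simp: \<phi>_def)
    ultimately show "\<phi> Q * (\<phi> (Q + x) - \<phi> (Q + t * x)) = \<phi> ((1 - t) * Q) * (\<phi> (Q + x) - \<phi> Q)"
      by (simp add: step_modular_def \<phi>_def[symmetric] field_simps)
  qed fact
  from this[of "G1 t"] show ?thesis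
    using H_G1[OF assms] phi_function_nonneg[OF G1 assms] by (simp add: \<phi>_def)
qed

end

theorem theorem7:
  fixes \<Omega> :: "real set" and F1 G1 F2 G2 :: "real \<Rightarrow> real"
  assumes "\<Omega> = {0..1} \<or> \<Omega> = {0..}"
    and "phi_function F1" and "phi_function G1"
    and "phi_function F2" and "phi_function G2"
    and "\<And>f. f \<in> orlicz_lorentz_space (lebesgue_on \<Omega>) F1 G1 \<Longrightarrow>
           orlicz_lorentz_norm (lebesgue_on \<Omega>) F1 G1 f = orlicz_lorentz_norm (lebesgue_on \<Omega>) F2 G2 f"
  shows "(\<Omega> = {0..1} \<longrightarrow> (\<forall>t\<ge>1. F1 t = F2 t \<and> G1 t = G2 t)) \<and>
         (\<Omega> = {0..} \<longrightarrow> (\<forall>t\<ge>0. F1 t = F2 t \<and> G1 t = G2 t))"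
proof (intro conjI impI allI)
  fix t :: real assume \<Omega>: "\<Omega> = {0..1}" and t: "1 \<le> t"
  \<comment> \<open>\<open>F q \<ge> F 1 = 1\<close>, so the interval has length at most 1.\<close>
  have sub: "{0..1 / F q} \<subseteq> \<Omega>" if F: "phi_function F" and q: "0 < q" "1 \<le> q" for F q
    using phi_function_le_iff[OF F, of 1 q] F q \<Omega> by (auto simp: phi_function_def field_simps)
  have sets: "\<Omega> \<in> sets lebesgue" "\<Omega> \<subseteq> {0..}" by (auto simp: \<Omega>)
  have \<tau>: "(1::real) = 0 \<or> (1::real) = 1" by simp
  show "F1 t = F2 t"
    by (rule isometry_imp_F_eq[where \<Omega> = \<Omega> and p = t and \<tau> = 1, OF assms(2-5) sets _ \<tau>])
       (use t sub assms(6) in simp_all)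
  show "G1 t = G2 t"
    by (rule isometry_imp_G_eq[where \<Omega> = \<Omega> and t = t and \<tau> = 1, OF assms(2-5) sets _ \<tau>])
       (use t sub assms(6) in simp_all)
next
  fix t :: real assume \<Omega>: "\<Omega> = {0..}" and t: "0 \<le> t"
  have sub: "{0..1 / F q} \<subseteq> \<Omega>" if "phi_function F" "0 < q" "0 \<le> q" for F q
    using \<Omega> by auto
  have sets: "\<Omega> \<in> sets lebesgue" "\<Omega> \<subseteq> {0..}" by (auto simp: \<Omega>)
  have \<tau>: "(0::real) = 0 \<or> (0::real) = 1" by simp
  show "G1 t = G2 t"
    by (rule isometry_imp_G_eq[where \<Omega> = \<Omega> and t = t and \<tau> = 0, OF assms(2-5) sets _ \<tau>])
       (use t sub assms(6) in simp_all)
  show "F1 t = F2 t"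
  \<comment> \<open>The indicator argument needs a positive argument; at 0 both functions vanish by
    definition.\<close>
  proof (cases "t = 0")
    case True
    then show ?thesis using assms(2,4) by (simp add: phi_function_0)
  next
    case False
    show ?thesis
      by (rule isometry_imp_F_eq[where \<Omega> = \<Omega> and p = t and \<tau> = 0, OF assms(2-5) sets _ \<tau>])
         (use t False sub assms(6) in simp_all)
  qed
qed

end
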